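(* Let $G$ be a finite group with commutator subgroup $G'$, and let $\mathcal C=\mathcal C(\mathcal B(G),\mathcal F(G))$ be the class semigroup of $\mathcal B(G)$ in $\mathcal F(G)$. If $\mathcal C$ is a Clifford semigroup, then $|G'|\le 2$.
   Context: Let $G$ be a finite group with identity $1_G$. $\mathcal F(G)$ is the free abelian monoid with basis $G$, its operation written $\cdot$ ; its elements are called sequences over $G$ (finite, unordered, repetition allowed), and its identity is the empty sequence $1_{\mathcal F(G)}$. For $S=g_1\cdot\ldots\cdot g_\ell$, $\pi(S)=\{g_{\tau(1)}\cdots g_{\tau(\ell)}\in G \mid \tau \text{ a permutation of } [1,\ell]\}$, with $\pi(1_{\mathcal F(G)})=\{1_G\}$. The monoid of product-one sequences is $\mathcal B(G)=\{S\in\mathcal F(G)\mid 1_G\in\pi(S)\}$. For $S,S'\in\mathcal F(G)$ write $S\sim S'$ if for all $T\in\mathcal F(G)$: $S\cdot T\in\mathcal B(G)\Leftrightarrow S'\cdot T\in\mathcal B(G)$. This is a congruence; $[S]$ is the class of $S$, and $\mathcal C(\mathcal B(G),\mathcal F(G))=\{[S]\mid S\in\mathcal F(G)\}$, with $[S]+[S']=[S\cdot S']$, is the class semigroup (a finite commutative semigroup with identity $[1_{\mathcal F(G)}]$). It is a Clifford semigroup if every element lies in a subgroup of it (a subsemigroup that is a group, possibly with a different identity element). *)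

theory Defs
  imports "HOL-Algebra.Algebra" "HOL-Library.Multiset"
begin

text \<open>Sequences over \<open>G\<close> are finite multisets of elements of \<open>G\<close>;
  the free abelian monoid on \<open>G\<close> is their set under multiset sum.\<close>

definition sequence_monoid :: "('a, 'b) monoid_scheme \<Rightarrow> 'a multiset monoid" where
  "sequence_monoid G =
     \<lparr>carrier = {S. set_mset S \<subseteq> carrier G}, monoid.mult = (+), one = {#}\<rparr>"

text \<open>The lists \<open>xs\<close> with \<open>mset xs = S\<close> are exactly the orderings
  \<open>g\<^bsub>\<tau>(1)\<^esub>, \<dots>, g\<^bsub>\<tau>(\<ell>)\<^esub>\<close> of the terms of \<open>S\<close>.\<close>

definition sequence_products :: "('a, 'b) monoid_scheme \<Rightarrow> 'a multiset \<Rightarrow> 'a set" where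
  "sequence_products G S = {foldr (\<otimes>\<^bsub>G\<^esub>) xs \<one>\<^bsub>G\<^esub> | xs. mset xs = S}"

definition product_one_sequences :: "('a, 'b) monoid_scheme \<Rightarrow> 'a multiset set" where
  "product_one_sequences G =
     {S \<in> carrier (sequence_monoid G). \<one>\<^bsub>G\<^esub> \<in> sequence_products G S}"

definition class_rel :: "('a, 'b) monoid_scheme \<Rightarrow> 'a set \<Rightarrow> ('a \<times> 'a) set" where
  "class_rel F H = {(x, y). x \<in> carrier F \<and> y \<in> carrier F \<and>
     (\<forall>z \<in> carrier F. x \<otimes>\<^bsub>F\<^esub> z \<in> H \<longleftrightarrow> y \<otimes>\<^bsub>F\<^esub> z \<in> H)}"

text \<open>On classes the union below is the single class of \<open>x \<otimes> y\<close>; see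
  \<open>class_semigroup_mult\<close>. The operation, additive in the literature, is the
  \<open>mult\<close> field of the record.\<close>

definition class_semigroup :: "('a, 'b) monoid_scheme \<Rightarrow> 'a set \<Rightarrow> 'a set monoid" where
  "class_semigroup F H =
     \<lparr>carrier = carrier F // class_rel F H,
      monoid.mult = (\<lambda>A B. \<Union>x\<in>A. \<Union>y\<in>B. class_rel F H `` {x \<otimes>\<^bsub>F\<^esub> y}),
      one = class_rel F H `` {\<one>\<^bsub>F\<^esub>}\<rparr>"

text \<open>The identity \<open>e\<close> of the subgroup \<open>K\<close> may differ from \<open>one M\<close>. This notion
  (every element lies in a subgroup) is only meant for commutative \<open>M\<close>; for
  noncommutative semigroups, Clifford semigroups also have central idempotents.\<close>

definition clifford_semigroup :: "'a monoid \<Rightarrow> bool" where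
  "clifford_semigroup M \<longleftrightarrow>
     (\<forall>x \<in> carrier M. \<exists>K e. K \<subseteq> carrier M \<and> x \<in> K \<and>
        group (M\<lparr>carrier := K, one := e\<rparr>))"

lemma comm_monoid_sequence_monoid: "comm_monoid (sequence_monoid G)"
  by (rule comm_monoidI) (auto simp: sequence_monoid_def ac_simps)

lemma sequence_products_empty: "sequence_products G {#} = {\<one>\<^bsub>G\<^esub>}"
  by (auto simp: sequence_products_def)

lemma equiv_class_rel: "equiv (carrier F) (class_rel F H)"
  by (intro equivI) (auto simp: class_rel_def refl_on_def sym_def trans_def)

context comm_monoid
begin

lemma class_rel_mult_cong:
  assumes "(x, x') \<in> class_rel G H" "(y, y') \<in> class_rel G H"
  shows "(x \<otimes> y, x' \<otimes> y') \<in> class_rel G H"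
proof -
  have c: "x \<in> carrier G" "x' \<in> carrier G" "y \<in> carrier G" "y' \<in> carrier G"
    using assms by (auto simp: class_rel_def)
  have "(x \<otimes> y) \<otimes> z \<in> H \<longleftrightarrow> (x' \<otimes> y') \<otimes> z \<in> H" if z: "z \<in> carrier G" for z
  proof -
    have "(x \<otimes> y) \<otimes> z \<in> H \<longleftrightarrow> x \<otimes> (y \<otimes> z) \<in> H" using c z by (simp add: m_assoc)
    also have "\<dots> \<longleftrightarrow> x' \<otimes> (y \<otimes> z) \<in> H" using assms(1) c z by (auto simp: class_rel_def)
    also have "\<dots> \<longleftrightarrow> y \<otimes> (x' \<otimes> z) \<in> H" using c z by (simp add: m_lcomm)
    also have "\<dots> \<longleftrightarrow> y' \<otimes> (x' \<otimes> z) \<in> H" using assms(2) c z by (auto simp: class_rel_def)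
    also have "\<dots> \<longleftrightarrow> (x' \<otimes> y') \<otimes> z \<in> H" using c z by (simp add: m_assoc m_lcomm)
    finally show ?thesis .
  qed
  with c show ?thesis by (auto simp: class_rel_def)
qed

lemma class_semigroup_mult:
  assumes "x \<in> carrier G" "y \<in> carrier G"
  shows "class_rel G H `` {x} \<otimes>\<^bsub>class_semigroup G H\<^esub> class_rel G H `` {y}
           = class_rel G H `` {x \<otimes> y}"
proof -
  have "congruent2 (class_rel G H) (class_rel G H) (\<lambda>x y. class_rel G H `` {x \<otimes> y})"
    by (intro congruent2I') (meson class_rel_mult_cong equiv_class_eq equiv_class_rel)
  from UN_equiv_class2[OF equiv_class_rel equiv_class_rel this assms]
  show ?thesis by (simp add: class_semigroup_def)
qed

lemma comm_monoid_class_semigroup: "comm_monoid (class_semigroup G H)"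
proof -
  have one: "\<one>\<^bsub>class_semigroup G H\<^esub> = class_rel G H `` {\<one>}"
    by (simp add: class_semigroup_def)
  have car: "A \<in> carrier (class_semigroup G H) \<longleftrightarrow>
      (\<exists>x \<in> carrier G. A = class_rel G H `` {x})" for A
    by (auto simp: class_semigroup_def quotient_def)
  show ?thesis
    by (rule comm_monoidI) (auto simp: car one class_semigroup_mult m_ac)
qed

end

end

theory Submission
  imports Defs
begin

text \<open>If the class of \<open>S\<close> lies in a subgroup of the class semigroup, then for some \<open>U\<close> the sequence
  \<open>S\<close> is equivalent to \<open>S + n (S + U)\<close> for every \<open>n\<close>. Taking \<open>n\<close> divisible by \<open>|G|\<close>, the set of
  products of \<open>S\<close> is stable under multiplication by commutators of powers of terms of \<open>S\<close>. For \<open>S = {a, b}\<close>,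
  where there are only the products \<open>ab\<close> and \<open>ba\<close>, this makes all squares central; hence commutators
  are central, of order at most two and bimultiplicative. For \<open>S = {a, b, c}\<close>, with at most six
  products, it forces nontrivial commutators with a common entry to agree. By
  bimultiplicativity all nontrivial commutators agree.\<close>

section \<open>Ordered products and the sets of products of sequences\<close>

lemma set_mset_repeat_mset_subset: "set_mset (repeat_mset n M) \<subseteq> set_mset M"
  by (auto simp flip: count_greater_zero_iff)

context group
begin

abbreviation list_product :: "'a list \<Rightarrow> 'a" where
  "list_product xs \<equiv> foldr (\<otimes>) xs \<one>"

text \<open>In this convention left multiplication by \<open>comm a b\<close> turns
  \<open>b \<otimes> a\<close> into \<open>a \<otimes> b\<close>, and the values are the elements of
  \<open>derived_set G (carrier G)\<close>.\<close>

abbreviation comm :: "'a \<Rightarrow> 'a \<Rightarrow> 'a" where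
  "comm a b \<equiv> a \<otimes> b \<otimes> inv a \<otimes> inv b"

lemma inv_mult_cancel:
  assumes "a \<in> carrier G" "b \<in> carrier G"
  shows "inv a \<otimes> (a \<otimes> b) = b" "a \<otimes> (inv a \<otimes> b) = b"
  using assms by (simp_all flip: m_assoc)

lemma commute_mult:
  assumes "c \<in> carrier G" "x \<in> carrier G" "y \<in> carrier G"
    and "c \<otimes> x = x \<otimes> c" "c \<otimes> y = y \<otimes> c"
  shows "c \<otimes> (x \<otimes> y) = x \<otimes> y \<otimes> c"
proof -
  have "c \<otimes> (x \<otimes> y) = x \<otimes> c \<otimes> y"
    using assms by (simp flip: m_assoc)
  then show ?thesis
    using assms by (simp add: m_assoc)
qed

lemma list_product_closed [simp]:
  "set xs \<subseteq> carrier G \<Longrightarrow> list_product xs \<in> carrier G"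
  by (induction xs) auto

lemma list_product_append:
  "set xs \<subseteq> carrier G \<Longrightarrow> set ys \<subseteq> carrier G \<Longrightarrow>
     list_product (xs @ ys) = list_product xs \<otimes> list_product ys"
  by (induction xs) (auto simp: m_assoc)

lemma list_product_replicate:
  "a \<in> carrier G \<Longrightarrow> list_product (replicate n a) = a [^] n"
  by (induction n) (auto simp flip: nat_pow_Suc2)

lemma sequence_productsI: "mset xs = S \<Longrightarrow> list_product xs \<in> sequence_products G S"
  by (auto simp: sequence_products_def)

lemma sequence_products_closed:
  "p \<in> sequence_products G S \<Longrightarrow> set_mset S \<subseteq> carrier G \<Longrightarrow> p \<in> carrier G"
  by (auto simp: sequence_products_def)

lemma sequence_products_add:
  assumes "p \<in> sequence_products G S" "q \<in> sequence_products G T"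
    and "set_mset S \<subseteq> carrier G" "set_mset T \<subseteq> carrier G"
  shows "p \<otimes> q \<in> sequence_products G (S + T)"
proof -
  obtain xs ys where xs: "mset xs = S" "p = list_product xs"
    and ys: "mset ys = T" "q = list_product ys"
    using assms(1,2) by (auto simp: sequence_products_def)
  have "p \<otimes> q = list_product (xs @ ys)"
    using xs ys assms(3,4) by (auto simp: list_product_append simp del: foldr_append)
  then show ?thesis
    using sequence_productsI[of "xs @ ys" "S + T"] xs ys by simp
qed

text \<open>Each term of \<open>R\<close> contributes a power whose exponent is a multiple of the
  group order. For infinite \<open>G\<close>, \<open>order G\<close> is 0 and the repeated sequence
  is empty.\<close>

lemma one_in_sequence_products_repeat:
  "set_mset R \<subseteq> carrier G \<Longrightarrow> \<one> \<in> sequence_products G (repeat_mset (order G * m) R)"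
proof (induction R)
  case empty
  then show ?case by (simp add: sequence_products_empty)
next
  case (add a R)
  have a: "a \<in> carrier G" using add.prems by simp
  have "a [^] (order G * m) = \<one>"
    using a by (simp add: nat_pow_pow [symmetric] pow_order_eq_1)
  then have "\<one> \<in> sequence_products G (replicate_mset (order G * m) a)"
    using sequence_productsI[of "replicate (order G * m) a"] a
    by (simp add: list_product_replicate del: foldr_replicate)
  from sequence_products_add[OF this add.IH] add.prems
  show ?case using set_mset_repeat_mset_subset[of "order G * m" R] by auto
qed

text \<open>A product equal to one may be rotated cyclically, so its last factor can be chosen
  freely.\<close>

lemma add_mset_product_one_iff:
  assumes "set_mset S \<subseteq> carrier G" "g \<in> carrier G"
  shows "add_mset (inv g) S \<in> product_one_sequences G \<longleftrightarrow> g \<in> sequence_products G S"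
proof
  assume "add_mset (inv g) S \<in> product_one_sequences G"
  then obtain xs where xs: "mset xs = add_mset (inv g) S" "\<one> = list_product xs"
    by (auto simp: product_one_sequences_def sequence_products_def)
  then have "inv g \<in> set xs" by (metis set_mset_mset union_single_eq_member)
  then obtain l r where lr: "xs = l @ inv g # r" by (meson split_list)
  have S: "mset (r @ l) = S" using xs lr by (simp add: add.commute)
  then have c: "set l \<subseteq> carrier G" "set r \<subseteq> carrier G"
    using assms(1) by auto
  have "\<one> = list_product l \<otimes> (inv g \<otimes> list_product r)"
    using xs(2) assms c unfolding lr by (subst (asm) list_product_append) auto
  then have "(inv g \<otimes> list_product r) \<otimes> list_product l = \<one>"
    using inv_comm[of "list_product l" "inv g \<otimes> list_product r"] c assms(2) by simp
  then have "inv g \<otimes> list_product (r @ l) = \<one>"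
    using c assms(2) by (simp add: list_product_append m_assoc del: foldr_append)
  then have "g \<otimes> (inv g \<otimes> list_product (r @ l)) = g"
    using assms(2) by simp
  then have "g = list_product (r @ l)"
    using c assms(2) inv_mult_cancel(2)[of g "list_product (r @ l)"]
    by (simp del: foldr_append)
  then show "g \<in> sequence_products G S"
    using S sequence_productsI by blast
next
  assume "g \<in> sequence_products G S"
  moreover have "inv g \<in> sequence_products G {#inv g#}"
    using sequence_productsI[of "[inv g]"] assms(2) by simp
  ultimately have "g \<otimes> inv g \<in> sequence_products G (S + {#inv g#})"
    using assms by (intro sequence_products_add) auto
  then show "add_mset (inv g) S \<in> product_one_sequences G"
    using assms by (auto simp: product_one_sequences_def sequence_monoid_def)
qed

text \<open>Testing the equivalence against the one-term sequences \<open>{#inv g#}\<close> detects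
  the products \<open>g\<close>. This is how information on classes becomes information on group
  elements.\<close>

lemma class_rel_sequence_products_eq:
  assumes "(S, T) \<in> class_rel (sequence_monoid G) (product_one_sequences G)"
  shows "sequence_products G S = sequence_products G T"
proof -
  have c: "set_mset S \<subseteq> carrier G" "set_mset T \<subseteq> carrier G"
    using assms by (auto simp: class_rel_def sequence_monoid_def)
  have "g \<in> sequence_products G S \<longleftrightarrow> g \<in> sequence_products G T" if g: "g \<in> carrier G" for g
  proof -
    have "\<forall>Z. set_mset Z \<subseteq> carrier G \<longrightarrow>
        (S + Z \<in> product_one_sequences G \<longleftrightarrow> T + Z \<in> product_one_sequences G)"
      using assms by (simp add: class_rel_def sequence_monoid_def)
    from this[rule_format, of "{#inv g#}"]
    have "add_mset (inv g) S \<in> product_one_sequences G \<longleftrightarrow>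
        add_mset (inv g) T \<in> product_one_sequences G"
      using g by simp
    then show ?thesis using c g by (simp add: add_mset_product_one_iff)
  qed
  then show ?thesis using c sequence_products_closed by blast
qed

section \<open>Products of short sequences, and commutators\<close>

lemma sequence_products_pair:
  assumes "a \<in> carrier G" "b \<in> carrier G"
  shows "sequence_products G {#a, b#} = {a \<otimes> b, b \<otimes> a}"
proof -
  have "xs = [a, b] \<or> xs = [b, a]" if "mset xs = {#a, b#}" for xs
  proof -
    have "length xs = 2" using that by (metis size_mset size_add_mset size_empty numeral_2_eq_2)
    then obtain x y where "xs = [x, y]"
      by (auto simp: numeral_2_eq_2 length_Suc_conv)
    with that show ?thesis by (auto simp: add_eq_conv_ex)
  qed
  then have "{xs. mset xs = {#a, b#}} = {[a, b], [b, a]}" by auto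
  moreover have "sequence_products G {#a, b#} = list_product ` {xs. mset xs = {#a, b#}}"
    by (auto simp: sequence_products_def)
  ultimately show ?thesis using assms by simp
qed

lemma sequence_products_triple:
  assumes "a \<in> carrier G" "b \<in> carrier G" "c \<in> carrier G"
    and "p \<in> sequence_products G {#a, b, c#}"
  shows "p \<in> {a \<otimes> b \<otimes> c, a \<otimes> c \<otimes> b, b \<otimes> a \<otimes> c, b \<otimes> c \<otimes> a, c \<otimes> a \<otimes> b, c \<otimes> b \<otimes> a}"
proof -
  obtain xs where xs: "mset xs = {#a, b, c#}" "p = list_product xs"
    using assms(4) by (auto simp: sequence_products_def)
  then have "length xs = 3" by (metis size_mset size_add_mset size_empty numeral_3_eq_3)
  then obtain x y z where "xs = [x, y, z]"
    by (auto simp: numeral_3_eq_3 length_Suc_conv)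
  with xs assms(1-3) show ?thesis
    by (auto simp: add_eq_conv_ex m_assoc)
qed

lemma comm_swap:
  "a \<in> carrier G \<Longrightarrow> b \<in> carrier G \<Longrightarrow> comm a b \<otimes> (b \<otimes> a) = a \<otimes> b"
  by (simp add: m_assoc inv_mult_cancel)

text \<open>Cancel \<open>b \<otimes> a\<close> in \<open>comm_swap\<close>. Commutators can thus be
  computed from the effect of a swap.\<close>

lemma comm_unique:
  assumes "a \<in> carrier G" "b \<in> carrier G" "w \<in> carrier G" "w \<otimes> (b \<otimes> a) = a \<otimes> b"
  shows "comm a b = w"
  using assms comm_swap[of a b] by (metis inv_closed m_closed right_cancel)

end

section \<open>The Clifford property and sets of products\<close>

locale clifford_class_group = group +
  assumes fin: "finite (carrier G)"
    and clifford: "clifford_semigroup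
           (class_semigroup (sequence_monoid G) (product_one_sequences G))"
begin

text \<open>In a subgroup with identity \<open>e\<close> containing the class of \<open>S\<close>,
  let the class of \<open>U\<close> be its inverse; then \<open>e\<close> is the class of
  \<open>S + U\<close> and fixes the class of \<open>S\<close>. As \<open>e\<close> need not be the
  identity of the semigroup, the summand \<open>S\<close> cannot be dropped from both sides.\<close>

lemma class_rel_double:
  assumes "set_mset S \<subseteq> carrier G"
  obtains U where "set_mset U \<subseteq> carrier G"
    and "(S, S + (S + U)) \<in> class_rel (sequence_monoid G) (product_one_sequences G)"
proof -
  interpret F: comm_monoid "sequence_monoid G" by (rule comm_monoid_sequence_monoid)
  let ?r = "class_rel (sequence_monoid G) (product_one_sequences G)"
  let ?M = "class_semigroup (sequence_monoid G) (product_one_sequences G)"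
  have S: "S \<in> carrier (sequence_monoid G)"
    using assms by (simp add: sequence_monoid_def)
  then have "?r `` {S} \<in> carrier ?M" by (auto simp: class_semigroup_def quotient_def)
  then obtain K e where K: "K \<subseteq> carrier ?M" "?r `` {S} \<in> K"
    and "group (?M\<lparr>carrier := K, one := e\<rparr>)"
    using clifford unfolding clifford_semigroup_def by blast
  then interpret K: group "?M\<lparr>carrier := K, one := e\<rparr>" by simp
  obtain y where y: "y \<in> K" "y \<otimes>\<^bsub>?M\<^esub> ?r `` {S} = e"
    using K.l_inv_ex[of "?r `` {S}"] K by auto
  obtain U where U: "U \<in> carrier (sequence_monoid G)" "y = ?r `` {U}"
    using y(1) K(1) by (auto simp: class_semigroup_def quotient_def)
  have "?r `` {S} = (y \<otimes>\<^bsub>?M\<^esub> ?r `` {S}) \<otimes>\<^bsub>?M\<^esub> ?r `` {S}"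
    using K.l_one[of "?r `` {S}"] K y by simp
  also have "\<dots> = ?r `` {(U \<otimes>\<^bsub>sequence_monoid G\<^esub> S) \<otimes>\<^bsub>sequence_monoid G\<^esub> S}"
    using S U by (simp add: F.class_semigroup_mult)
  also have "(U \<otimes>\<^bsub>sequence_monoid G\<^esub> S) \<otimes>\<^bsub>sequence_monoid G\<^esub> S = S + (S + U)"
    by (simp add: sequence_monoid_def)
  finally have "(S, S + (S + U)) \<in> ?r"
    using S U by (subst eq_equiv_class_iff[OF equiv_class_rel, symmetric]) (auto simp: sequence_monoid_def)
  with that U show ?thesis by (auto simp: sequence_monoid_def)
qed

lemma class_rel_repeat:
  assumes "set_mset S \<subseteq> carrier G"
  obtains U where "set_mset U \<subseteq> carrier G"
    and "\<And>n. (S, S + repeat_mset n (S + U))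
              \<in> class_rel (sequence_monoid G) (product_one_sequences G)"
proof -
  interpret F: comm_monoid "sequence_monoid G" by (rule comm_monoid_sequence_monoid)
  let ?r = "class_rel (sequence_monoid G) (product_one_sequences G)"
  obtain U where U: "set_mset U \<subseteq> carrier G" and r: "(S, S + (S + U)) \<in> ?r"
    using assms by (rule class_rel_double)
  have refl: "(T, T) \<in> ?r" if "set_mset T \<subseteq> carrier G" for T
    using that by (simp add: class_rel_def sequence_monoid_def)
  have "(S, S + repeat_mset n (S + U)) \<in> ?r" for n
  proof (induction n)
    case 0
    then show ?case using refl[OF assms] by simp
  next
    case (Suc n)
    have "set_mset (repeat_mset n (S + U)) \<subseteq> carrier G"
      using assms U set_mset_repeat_mset_subset[of n "S + U"] by auto
    \<comment> \<open>Adding \<open>n\<close> copies of \<open>S + U\<close> to both sides of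
      \<open>r\<close> gives the step from \<open>n\<close> to \<open>Suc n\<close>, with the same
      \<open>U\<close> throughout.\<close>
    from F.class_rel_mult_cong[OF r refl[OF this]]
    have "(S + repeat_mset n (S + U), S + repeat_mset (Suc n) (S + U)) \<in> ?r"
      by (simp add: sequence_monoid_def ac_simps)
    then show ?case
      using Suc equiv_class_rel[of "sequence_monoid G" "product_one_sequences G"]
      by (meson equivE transE)
  qed
  with U that show ?thesis by blast
qed

text \<open>Adding many copies of \<open>S\<close> does not enlarge the set of products of \<open>S\<close>; the copies not
  needed to form \<open>w\<close> cancel because their multiplicity is divisible by the group order.\<close>

lemma sequence_products_absorb:
  assumes "p \<in> sequence_products G S" "set_mset S \<subseteq> carrier G" "R \<subseteq># S"
    and "w \<in> sequence_products G (repeat_mset (order G * m) R)"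
  shows "w \<otimes> p \<in> sequence_products G S"
proof -
  let ?N = "order G * m"
  obtain U where U: "set_mset U \<subseteq> carrier G"
    and r: "(S, S + repeat_mset ?N (S + U))
              \<in> class_rel (sequence_monoid G) (product_one_sequences G)"
    using class_rel_repeat[OF assms(2)] by metis
  obtain D where D: "S = R + D" using assms(3) by (auto simp: subset_mset.le_iff_add)
  have c: "set_mset R \<subseteq> carrier G" "set_mset (D + U) \<subseteq> carrier G"
    using assms(2) U D by auto
  have cr: "set_mset (repeat_mset ?N T) \<subseteq> carrier G" if "set_mset T \<subseteq> carrier G" for T
    using that set_mset_repeat_mset_subset[of ?N T] by auto
  have "w \<otimes> p \<in> sequence_products G (repeat_mset ?N R + S)"
    using assms cr c by (intro sequence_products_add) auto
  from sequence_products_add[OF this one_in_sequence_products_repeat[OF c(2), of m]]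
  have "w \<otimes> p \<otimes> \<one> \<in> sequence_products G (repeat_mset ?N R + S + repeat_mset ?N (D + U))"
    using assms(2) cr c by auto
  also have "repeat_mset ?N R + S + repeat_mset ?N (D + U) = S + repeat_mset ?N (S + U)"
    unfolding D by (simp add: ac_simps)
  finally have "w \<otimes> p \<otimes> \<one> \<in> sequence_products G S"
    using class_rel_sequence_products_eq[OF r] by simp
  moreover have "w \<in> carrier G" "p \<in> carrier G"
    using assms cr[OF c(1)] sequence_products_closed by blast+
  ultimately show ?thesis by simp
qed

text \<open>Finite order turns the inverses in the commutator into positive powers. The resulting
  word uses \<open>a\<close> and \<open>b\<close> equally often, a multiple of
  \<open>order G\<close> times, so \<open>sequence_products_absorb\<close> applies with
  \<open>R = {#a, b#}\<close>.\<close>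

lemma sequence_products_comm_pow:
  assumes "p \<in> sequence_products G S" "set_mset S \<subseteq> carrier G" "{#a, b#} \<subseteq># S"
    and "i \<le> 2"
  shows "comm (a [^] (i::nat)) b \<otimes> p \<in> sequence_products G S"
proof -
  have ab: "a \<in> carrier G" "b \<in> carrier G"
    using assms(2,3) by (auto dest: mset_subset_eqD)
  \<comment> \<open>The factor 2 gives \<open>i \<le> ?N\<close> even in the trivial group, so
    \<open>?N - i\<close> is a true difference.\<close>
  let ?N = "order G * 2"
  have "order G > 0" using fin order_gt_0_iff_finite by blast
  then have N: "i \<le> ?N" "?N > 0" using assms(4) by auto
  have pow: "x [^] ?N = \<one>" if "x \<in> carrier G" for x
    using that by (metis nat_pow_one nat_pow_pow pow_order_eq_1)
  have "a [^] (?N - i) \<otimes> a [^] i = \<one>" "b [^] (?N - 1) \<otimes> b = \<one>"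
    using ab N pow by (simp_all add: nat_pow_mult nat_pow_Suc[symmetric] del: nat_pow_Suc)
  then have inv: "inv (a [^] i) = a [^] (?N - i)" "inv b = b [^] (?N - 1)"
    using ab by (auto intro: inv_equality)
  let ?ws = "replicate i a @ [b] @ replicate (?N - i) a @ replicate (?N - 1) b"
  have "mset ?ws = repeat_mset ?N {#a, b#}"
    using N by (intro multiset_eqI) auto
  moreover have "list_product ?ws = comm (a [^] i) b"
    using ab by (simp add: list_product_append list_product_replicate inv m_assoc set_replicate_conv_if
          del: foldr_append foldr_replicate)
  ultimately have "comm (a [^] i) b \<in> sequence_products G (repeat_mset ?N {#a, b#})"
    using sequence_productsI by metis
  from sequence_products_absorb[OF assms(1-3) this] show ?thesis .
qed

section \<open>Central squares and bimultiplicative commutators\<close>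

lemma square_commutes:
  assumes "a \<in> carrier G" "b \<in> carrier G"
  shows "(a \<otimes> a) \<otimes> b = b \<otimes> (a \<otimes> a)"
proof -
  \<comment> \<open>Exponent 1 would give nothing: \<open>comm a b \<otimes> (b \<otimes> a)\<close>
    is just \<open>a \<otimes> b\<close>, already a product. With exponent 2, one of the two
    possible values makes \<open>a\<close> and \<open>b\<close> commute, the other is the claim
    multiplied by \<open>inv a\<close>.\<close>
  have "comm (a [^] (2::nat)) b \<otimes> (b \<otimes> a) \<in> {a \<otimes> b, b \<otimes> a}"
    using assms sequence_products_comm_pow[of "b \<otimes> a" "{#a, b#}" a b 2]
    by (simp add: sequence_products_pair)
  moreover have "comm (a [^] (2::nat)) b \<otimes> (b \<otimes> a) = a \<otimes> a \<otimes> b \<otimes> inv a"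
    using assms by (simp add: numeral_2_eq_2 m_assoc inv_mult_group inv_mult_cancel)
  ultimately consider "a \<otimes> a \<otimes> b \<otimes> inv a = a \<otimes> b" | "a \<otimes> a \<otimes> b \<otimes> inv a = b \<otimes> a"
    by auto
  then show ?thesis
  proof cases
    case 1
    then have "a \<otimes> a \<otimes> b \<otimes> inv a \<otimes> a = a \<otimes> b \<otimes> a" by simp
    then have "a \<otimes> (a \<otimes> b) = a \<otimes> (b \<otimes> a)"
      using assms by (simp add: m_assoc)
    then have "a \<otimes> b = b \<otimes> a" using assms by simp
    moreover have "a \<otimes> a \<otimes> b = a \<otimes> (a \<otimes> b)" "a \<otimes> (b \<otimes> a) = a \<otimes> b \<otimes> a"
      using assms by (simp_all add: m_assoc)
    ultimately show ?thesis using assms by (simp add: m_assoc)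
  next
    case 2
    then have "a \<otimes> a \<otimes> b \<otimes> inv a \<otimes> a = b \<otimes> a \<otimes> a" by simp
    then show ?thesis using assms by (simp add: m_assoc)
  qed
qed

lemma comm_central:
  assumes "a \<in> carrier G" "b \<in> carrier G" "c \<in> carrier G"
  shows "c \<otimes> comm a b = comm a b \<otimes> c"
proof -
  let ?s = "a \<otimes> a" and ?t = "(inv a \<otimes> b) \<otimes> (inv a \<otimes> b)" and ?u = "inv b \<otimes> inv b"
  \<comment> \<open>A commutator is a product of three squares.\<close>
  have e: "comm a b = ?s \<otimes> (?t \<otimes> ?u)"
    using assms by (simp add: m_assoc inv_mult_cancel)
  have cl: "?s \<in> carrier G" "?t \<in> carrier G" "?u \<in> carrier G" using assms by auto
  have "c \<otimes> ?s = ?s \<otimes> c" "c \<otimes> ?t = ?t \<otimes> c" "c \<otimes> ?u = ?u \<otimes> c"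
    using assms by (intro square_commutes[symmetric]; simp)+
  then show ?thesis
    unfolding e using commute_mult[of c] cl assms(3) by simp
qed

lemma comm_lcomm:
  assumes "a \<in> carrier G" "b \<in> carrier G" "c \<in> carrier G" "d \<in> carrier G"
  shows "c \<otimes> (comm a b \<otimes> d) = comm a b \<otimes> (c \<otimes> d)"
proof -
  have "c \<otimes> (comm a b \<otimes> d) = c \<otimes> comm a b \<otimes> d"
    using assms m_assoc[of c "comm a b" d] by simp
  also have "\<dots> = comm a b \<otimes> (c \<otimes> d)"
    unfolding comm_central[OF assms(1-3)] using assms m_assoc[of "comm a b" c d] by simp
  finally show ?thesis .
qed

text \<open>Moving \<open>a\<close> past \<open>b\<close> and then past \<open>c\<close> produces
  one commutator each; by centrality both can be collected in front.\<close>

lemma comm_mult_right: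
  assumes "a \<in> carrier G" "b \<in> carrier G" "c \<in> carrier G"
  shows "comm a (b \<otimes> c) = comm a b \<otimes> comm a c"
proof (rule comm_unique)
  have "a \<otimes> (b \<otimes> c) = (comm a b \<otimes> (b \<otimes> a)) \<otimes> c"
    using assms comm_swap[of a b] by (simp add: m_assoc)
  also have "\<dots> = comm a b \<otimes> (b \<otimes> (comm a c \<otimes> (c \<otimes> a)))"
    using assms comm_swap[of a c] by (simp add: m_assoc)
  also have "\<dots> = comm a b \<otimes> (comm a c \<otimes> (b \<otimes> (c \<otimes> a)))"
    using assms comm_lcomm[of a c b "c \<otimes> a"] by simp
  finally show "comm a b \<otimes> comm a c \<otimes> (b \<otimes> c \<otimes> a) = a \<otimes> (b \<otimes> c)"
    using assms by (simp add: m_assoc)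
qed (use assms in auto)

lemma comm_sym:
  assumes "a \<in> carrier G" "b \<in> carrier G"
  shows "comm b a = inv (comm a b)"
  using assms by (simp add: inv_mult_group m_assoc)

lemma comm_self:
  assumes "a \<in> carrier G"
  shows "comm a a = \<one>"
  using assms by (simp add: m_assoc)

text \<open>By bimultiplicativity the square is \<open>comm a (b \<otimes> b)\<close>, which is
  trivial because squares are central.\<close>

lemma comm_square:
  assumes "a \<in> carrier G" "b \<in> carrier G"
  shows "comm a b \<otimes> comm a b = \<one>"
proof -
  have "comm a (b \<otimes> b) = \<one>"
    using assms square_commutes[of b a] by (intro comm_unique) auto
  then show ?thesis using assms comm_mult_right[of a b b] by simp
qed

lemma comm_commute:
  assumes "a \<in> carrier G" "b \<in> carrier G"
  shows "comm b a = comm a b"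
  using assms comm_square[of a b] unfolding comm_sym[OF assms]
  by (intro inv_equality) auto

lemma comm_mult_left:
  assumes "a \<in> carrier G" "b \<in> carrier G" "c \<in> carrier G"
  shows "comm (a \<otimes> b) c = comm a c \<otimes> comm b c"
  using assms comm_mult_right[of c a b] comm_commute[of c "a \<otimes> b"] comm_commute[of c a] comm_commute[of c b]
  by simp

section \<open>Coincidences between nontrivial commutators\<close>

text \<open>The commutators by which the six orderings of \<open>a, b, c\<close> differ do not fill the group that
  they generate, unless there is a coincidence.\<close>

lemma comm_triple:
  assumes abc: "a \<in> carrier G" "b \<in> carrier G" "c \<in> carrier G"
  shows "comm a b = \<one> \<or> comm a c = \<one> \<or> comm b c = \<one> \<or>
    comm a b = comm a c \<or> comm a b = comm b c \<or> comm a c = comm b c"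
proof -
  define p where "p = comm a b"
  define q where "q = comm a c"
  define r where "r = comm b c"
  define t where "t = a \<otimes> b \<otimes> c"
  have cl: "p \<in> carrier G" "q \<in> carrier G" "r \<in> carrier G" "t \<in> carrier G"
    using abc by (auto simp: p_def q_def r_def t_def)
  \<comment> \<open>Each other ordering of \<open>a, b, c\<close> is \<open>t\<close> times one
    commutator for every pair whose order is reversed.\<close>
  have acb: "a \<otimes> c \<otimes> b = r \<otimes> t"
    using abc comm_swap[of c b] comm_lcomm[of c b a "b \<otimes> c"] comm_commute[of c b]
    by (simp add: r_def t_def m_assoc)
  have bac: "b \<otimes> a \<otimes> c = p \<otimes> t"
  proof -
    have "b \<otimes> a \<otimes> c = (comm b a \<otimes> (a \<otimes> b)) \<otimes> c"
      using abc by (simp only: comm_swap)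
    then show ?thesis
      unfolding p_def t_def comm_commute[OF abc(2,1), symmetric]
      using abc by (simp only: m_assoc m_closed inv_closed)
  qed
  have bca: "b \<otimes> c \<otimes> a = p \<otimes> q \<otimes> t"
  proof -
    have "comm (b \<otimes> c) a = p \<otimes> q"
      using abc comm_mult_left[of b c a] comm_commute[of a b] comm_commute[of a c]
      by (simp add: p_def q_def)
    moreover have "b \<otimes> c \<otimes> a = comm (b \<otimes> c) a \<otimes> (a \<otimes> (b \<otimes> c))"
      using abc comm_swap[of "b \<otimes> c" a] by simp
    moreover have "a \<otimes> (b \<otimes> c) = t"
      using abc by (simp add: t_def m_assoc)
    ultimately show ?thesis by simp
  qed
  have cab: "c \<otimes> a \<otimes> b = q \<otimes> r \<otimes> t"
  proof -
    have "comm c (a \<otimes> b) = q \<otimes> r"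
      using abc comm_mult_right[of c a b] comm_commute[of a c] comm_commute[of b c]
      by (simp add: q_def r_def)
    moreover have "c \<otimes> (a \<otimes> b) = comm c (a \<otimes> b) \<otimes> (a \<otimes> b \<otimes> c)"
      using abc comm_swap[of c "a \<otimes> b"] by simp
    ultimately show ?thesis
      using abc by (simp add: t_def m_assoc)
  qed
  have cba: "c \<otimes> b \<otimes> a = q \<otimes> (r \<otimes> p) \<otimes> t"
  proof -
    have "comm c (b \<otimes> a) = r \<otimes> q"
      using abc comm_mult_right[of c b a] comm_commute[of a c] comm_commute[of b c]
      by (simp add: q_def r_def)
    moreover have "r \<otimes> q = q \<otimes> r"
      unfolding q_def using comm_central[OF abc(1,3) cl(3)] .
    moreover have "c \<otimes> (b \<otimes> a) = comm c (b \<otimes> a) \<otimes> (b \<otimes> a \<otimes> c)"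
      using abc comm_swap[of c "b \<otimes> a"] by simp
    ultimately have "c \<otimes> (b \<otimes> a) = q \<otimes> r \<otimes> (p \<otimes> t)"
      using bac by simp
    then show ?thesis
      using abc cl by (simp add: m_assoc)
  qed
  have "list_product [a, b, c] \<in> sequence_products G {#a, b, c#}"
    by (rule sequence_productsI) simp
  then have "t \<in> sequence_products G {#a, b, c#}"
    using abc by (simp add: t_def m_assoc)
  \<comment> \<open>No ordering reverses the pair \<open>a, c\<close> alone, so that
    \<open>q \<otimes> t\<close> is a product forces a coincidence among \<open>p\<close>,
    \<open>q\<close>, \<open>r\<close>.\<close>
  then have "comm (a [^] (1::nat)) c \<otimes> t \<in> sequence_products G {#a, b, c#}"
    using abc by (intro sequence_products_comm_pow) auto
  then have "q \<otimes> t \<in> sequence_products G {#a, b, c#}"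
    using abc by (simp add: q_def)
  from sequence_products_triple[OF abc this]
  have "q \<otimes> t \<in> {\<one> \<otimes> t, r \<otimes> t, p \<otimes> t, p \<otimes> q \<otimes> t, q \<otimes> r \<otimes> t, q \<otimes> (r \<otimes> p) \<otimes> t}"
    unfolding acb bac bca cab cba using cl by (simp add: t_def)
  then have "q \<in> {\<one>, r, p, p \<otimes> q, q \<otimes> r, q \<otimes> (r \<otimes> p)}"
    using cl by (simp only: insert_iff empty_iff right_cancel one_closed m_closed)
  \<comment> \<open>This treats the option \<open>q = q \<otimes> (r \<otimes> p)\<close>;
    \<open>p\<close> is its own inverse.\<close>
  moreover have "p = r" if "r \<otimes> p = \<one>"
    using that comm_square[OF abc(1,2)] cl by (metis p_def right_cancel)
  ultimately have "p = \<one> \<or> q = \<one> \<or> r = \<one> \<or> p = q \<or> p = r \<or> q = r"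
    using cl l_cancel_one'[of q r] l_cancel_one'[of q "r \<otimes> p"] r_cancel_one'[of q p]
    by auto
  then show ?thesis by (simp add: p_def q_def r_def)
qed

text \<open>For \<open>a, b, c\<close> themselves \<open>comm_triple\<close> is void, since
  \<open>comm b c\<close> is trivial. For \<open>a\<close>, \<open>a \<otimes> b\<close>,
  \<open>a \<otimes> c\<close> the three commutators are \<open>p\<close>, \<open>q\<close>,
  \<open>q \<otimes> p\<close>, and each alternative yields \<open>p = q\<close> or makes
  \<open>p\<close> or \<open>q\<close> trivial.\<close>

lemma comm_eq_if_commute:
  assumes abc: "a \<in> carrier G" "b \<in> carrier G" "c \<in> carrier G"
    and "comm b c = \<one>" "comm a b \<noteq> \<one>" "comm a c \<noteq> \<one>"
  shows "comm a b = comm a c"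
proof -
  define p where "p = comm a b"
  define q where "q = comm a c"
  have cl: "p \<in> carrier G" "q \<in> carrier G"
    using abc by (auto simp: p_def q_def)
  have 1: "comm a (a \<otimes> b) = p" "comm a (a \<otimes> c) = q"
    using abc comm_mult_right[of a a] by (simp_all add: comm_self p_def q_def)
  have "comm b (a \<otimes> c) = p"
    using abc assms(4) comm_mult_right[of b a c] comm_commute[of a b] by (simp add: p_def)
  then have 2: "comm (a \<otimes> b) (a \<otimes> c) = q \<otimes> p"
    using abc comm_mult_left[of a b "a \<otimes> c"] 1 by simp
  have "q = p" if "q \<otimes> p = \<one>"
    using that comm_square[OF abc(1,2)] cl by (metis p_def right_cancel)
  moreover have "p \<noteq> \<one>" "q \<noteq> \<one>" using assms(5,6) by (auto simp: p_def q_def)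
  ultimately have "p = q"
    using comm_triple[of a "a \<otimes> b" "a \<otimes> c"] abc cl unfolding 1 2
    by (auto simp: l_cancel_one' r_cancel_one')
  then show ?thesis by (simp add: p_def q_def)
qed

text \<open>Unless the equality is immediate or \<open>b\<close> and \<open>c\<close> commute,
  multiplying one of them by \<open>a\<close> makes them commute, because two equal commutators
  cancel. The commutators with \<open>a\<close> do not change.\<close>

lemma comm_eq_shared:
  assumes abc: "a \<in> carrier G" "b \<in> carrier G" "c \<in> carrier G"
    and ne: "comm a b \<noteq> \<one>" "comm a c \<noteq> \<one>"
  shows "comm a b = comm a c"
proof -
  consider "comm b c = \<one>" | "comm a c = comm b c" | "comm a b = comm b c" | "comm a b = comm a c"
    using comm_triple[OF abc] ne by blast
  then show ?thesis
  proof cases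
    case 1
    then show ?thesis using comm_eq_if_commute abc ne by blast
  next
    case 2
    have "comm (a \<otimes> b) c = \<one>"
      using abc 2 comm_mult_left[of a b c] comm_square[of b c] by simp
    moreover have "comm a (a \<otimes> b) = comm a b"
      using abc comm_mult_right[of a a b] by (simp add: comm_self)
    ultimately show ?thesis
      using comm_eq_if_commute[of a "a \<otimes> b" c] abc ne by simp
  next
    case 3
    have "comm b (a \<otimes> c) = \<one>"
      using abc 3 comm_mult_right[of b a c] comm_commute[of a b] comm_square[of b c] by simp
    moreover have "comm a (a \<otimes> c) = comm a c"
      using abc comm_mult_right[of a a c] by (simp add: comm_self)
    ultimately show ?thesis
      using comm_eq_if_commute[of a b "a \<otimes> c"] abc ne by simp
  qed
qed

lemma comm_eq:
  assumes abcd: "a \<in> carrier G" "b \<in> carrier G" "c \<in> carrier G" "d \<in> carrier G"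
    and ne: "comm a b \<noteq> \<one>" "comm c d \<noteq> \<one>"
  shows "comm a b = comm c d"
proof -
  \<comment> \<open>A nontrivial \<open>comm x z\<close> shares an entry with both commutators and
    links them.\<close>
  have step: "comm x y = comm z w"
    if "x \<in> carrier G" "y \<in> carrier G" "z \<in> carrier G" "w \<in> carrier G"
      "comm x y \<noteq> \<one>" "comm z w \<noteq> \<one>" "comm x z \<noteq> \<one>" for x y z w
    using that comm_eq_shared[of x y z] comm_eq_shared[of z x w] comm_commute[of x z] by simp
  show ?thesis
  proof (cases "comm b c = \<one> \<and> comm a d = \<one>")
    case True
    \<comment> \<open>With these two cross commutators trivial, \<open>a \<otimes> c\<close> acts
      like \<open>a\<close> on \<open>b\<close> and like \<open>c\<close> on \<open>d\<close>, which
      creates a shared entry.\<close>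
    have "comm (a \<otimes> c) b = comm a b"
      using abcd True comm_mult_left[of a c b] comm_commute[of b c] by simp
    moreover have "comm (a \<otimes> c) d = comm c d"
      using abcd True comm_mult_left[of a c d] by simp
    ultimately show ?thesis
      using comm_eq_shared[of "a \<otimes> c" b d] abcd ne by simp
  next
    case False
    then show ?thesis
      using step[of b a c d] step[of a b d c] comm_commute[of a b] comm_commute[of c d] abcd ne
      by auto
  qed
qed

text \<open>All commutators lie in some \<open>{\<one>, x}\<close> with \<open>x\<close> its own
  inverse. This set is already a subgroup, so it contains what they generate.\<close>

lemma card_derived_le_2: "card (derived G (carrier G)) \<le> 2"
proof -
  \<comment> \<open>Take for \<open>x\<close> a nontrivial commutator if there is one, and
    \<open>\<one>\<close> otherwise.\<close>
  obtain x where x: "x \<in> carrier G" "x \<otimes> x = \<one>" "derived_set G (carrier G) \<subseteq> {\<one>, x}"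
  proof (cases "\<exists>a\<in>carrier G. \<exists>b\<in>carrier G. comm a b \<noteq> \<one>")
    case True
    then obtain a b where ab: "a \<in> carrier G" "b \<in> carrier G" "comm a b \<noteq> \<one>" by blast
    have "derived_set G (carrier G) \<subseteq> {\<one>, comm a b}"
      using comm_eq[OF _ _ ab(1,2) _ ab(3)] by blast
    then show ?thesis using that[of "comm a b"] comm_square ab by simp
  next
    case False
    then show ?thesis using that[of \<one>] by auto
  qed
  have "inv x = x" using x by (simp add: inv_equality)
  then have "subgroup {\<one>, x} G"
    using x by (intro subgroupI) auto
  then have "derived G (carrier G) \<subseteq> {\<one>, x}"
    unfolding derived_def using x(3) by (intro generate_subgroup_incl)
  then have "card (derived G (carrier G)) \<le> card {\<one>, x}"
    by (intro card_mono) auto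
  also have "\<dots> \<le> 2" by (simp add: card_insert_if)
  finally show ?thesis .
qed

end

theorem theorem3p11:
  fixes G (structure)
  assumes "group G" and "finite (carrier G)"
    and "clifford_semigroup
           (class_semigroup (sequence_monoid G) (product_one_sequences G))"
  shows "card (derived G (carrier G)) \<le> 2"
proof -
  interpret clifford_class_group G
    using assms by (simp add: clifford_class_group_def clifford_class_group_axioms_def)
  show ?thesis by (rule card_derived_le_2)
qed

end
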